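(* Let $(X,\mu)$ be a measure space with $0<\mu(X)<\infty$, and let $f,g\in L^1(X,\mu)$ with $f\ge0$ and $g\ge0$. Let $b>0$, $c>0$ and define $b_*=\max(b,\frac1b)$, $c_*=\max(c,\frac1c)$. If $(f,g)$ is weakly $(b,c)$-synchronous, then $$\int_Xf g\,d\mu\ge\frac{b_*^{-1}+c_*^{-1}}{1+b_*c_*}\,\frac1{\mu(X)}\Big(\int_Xg\,d\mu\Big)\Big(\int_Xf\,d\mu\Big).$$ If $(f,g)$ is weakly $(b,c)$-asynchronous, then $$\int_Xfg\,d\mu\le\frac{b_*+c_*}{1+b_*^{-1}c_*^{-1}}\,\frac1{\mu(X)}\Big(\int_Xg\,d\mu\Big)\Big(\int_Xf\,d\mu\Big).$$ The special case $b=c=1$ implies the classical Chebyshev integral inequality.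
   Context: $(f,g)$ is weakly $(b,c)$-synchronous if for all $x,y\in X$: either ($f(x)\le bf(y)$ and $g(x)\le cg(y)$) or ($f(y)\le bf(x)$ and $g(y)\le cg(x)$). $(f,g)$ is weakly $(b,c)$-asynchronous if for all $x,y\in X$: either ($f(x)\le bf(y)$ and $cg(x)\ge g(y)$) or ($f(y)\le bf(x)$ and $cg(y)\ge g(x)$). The classical Chebyshev inequality: if $(f(x)-f(y))(g(x)-g(y))\ge0$ (resp. $\le0$) for all $x,y$, then $\int fg\,d\mu\ge$ (resp. $\le$) $\frac1{\mu(X)}\int f\,d\mu\int g\,d\mu$. *)

theory Defs
  imports "HOL-Analysis.Analysis"
begin

definition weakly_synchronous ::
    "'a set \<Rightarrow> real \<Rightarrow> real \<Rightarrow> ('a \<Rightarrow> real) \<Rightarrow> ('a \<Rightarrow> real) \<Rightarrow> bool" where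
  "weakly_synchronous X b c f g \<longleftrightarrow>
     (\<forall>x\<in>X. \<forall>y\<in>X. (f x \<le> b * f y \<and> g x \<le> c * g y) \<or> (f y \<le> b * f x \<and> g y \<le> c * g x))"

definition weakly_asynchronous ::
    "'a set \<Rightarrow> real \<Rightarrow> real \<Rightarrow> ('a \<Rightarrow> real) \<Rightarrow> ('a \<Rightarrow> real) \<Rightarrow> bool" where
  "weakly_asynchronous X b c f g \<longleftrightarrow>
     (\<forall>x\<in>X. \<forall>y\<in>X. (f x \<le> b * f y \<and> c * g x \<ge> g y) \<or> (f y \<le> b * f x \<and> c * g y \<ge> g x))"

definition star :: "real \<Rightarrow> real" where
  "star b = max b (1 / b)"

text \<open>The integral of a measurable real function whose positive or negative part has finite
  integral, with values in the extended reals.  The product of two integrable functions need not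
  be integrable, and the Bochner integral of a non-integrable function is 0 by convention.
  If both parts have infinite integral the value is meaningless, so uses of this definition
  should exclude that case.\<close>
definition ext_integral :: "'a measure \<Rightarrow> ('a \<Rightarrow> real) \<Rightarrow> ereal" where
  "ext_integral M h =
     enn2ereal (\<integral>\<^sup>+ x. ennreal (h x) \<partial>M) - enn2ereal (\<integral>\<^sup>+ x. ennreal (- h x) \<partial>M)"

end

theory Submission
  imports Defs
begin

text \<open>
  All four inequalities are instances of one averaging principle.  Suppose that
  \<open>k * (f x * g y + f y * g x) \<le> h x + h y\<close> for all points \<open>x\<close> and \<open>y\<close>, with \<open>f\<close> and \<open>g\<close>
  integrable over a finite measure of total mass \<open>m > 0\<close>.  Integrating in \<open>x\<close> and then in \<open>y\<close>
  gives \<open>2 * k * F * G \<le> 2 * m * H\<close>, where \<open>F\<close>, \<open>G\<close>, \<open>H\<close> are the integrals of \<open>f\<close>, \<open>g\<close>, \<open>h\<close>.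
  The function \<open>h\<close>, here plus or minus the product \<open>f * g\<close>, need not be integrable, but
  freezing \<open>y\<close> bounds it below by an integrable function, so its integral always makes sense in
  \<open>(-\<infinity>, \<infinity>]\<close>; if it is infinite, the lower bound is trivial.  This is
  \<open>ext_integral_lower_bound\<close>.

  For the classical inequality the pointwise hypothesis is the expansion of
  \<open>(u x - u y) * (v x - v y)\<close>, with \<open>k\<close> equal to 1 or -1.  For the weak notions put
  \<open>S = max (star b) (star c)\<close>.  Enlarging both constants to \<open>S \<ge> 1\<close>, a pair ordered up to the
  factor \<open>S\<close> satisfies a rearrangement inequality with the same factor \<open>S\<close>
  (\<open>rearrangement_up_to_factor\<close>).  Averaging then yields the bounds with \<open>1 / S\<close> and \<open>S\<close>,
  which are at least as sharp as the stated constants (\<open>sync_constant_le\<close>,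
  \<open>async_constant_ge\<close>).
\<close>

section \<open>Averaging a symmetric pointwise inequality\<close>

lemma ext_integral_eq_integral:
  assumes "integrable M h"
  shows "ext_integral M h = ereal (\<integral>x. h x \<partial>M)"
proof -
  have fin: "(\<integral>\<^sup>+ x. ennreal (h x) \<partial>M) < \<infinity>" "(\<integral>\<^sup>+ x. ennreal (- h x) \<partial>M) < \<infinity>"
    using assms by (simp_all add: real_integrable_def less_top)
  have "enn2ereal a - enn2ereal b = ereal (enn2real a - enn2real b)"
    if "a < \<infinity>" "b < \<infinity>" for a b
    using that by (cases a; cases b) (auto simp: enn2ereal_ennreal)
  then show ?thesis
    unfolding ext_integral_def using fin by (simp add: real_lebesgue_integral_def[OF assms])
qed

lemma ext_integral_uminus:
  assumes "(\<integral>\<^sup>+ x. ennreal (- h x) \<partial>M) < \<infinity>"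
  shows "ext_integral M (\<lambda>x. - h x) = - ext_integral M h"
proof -
  have "enn2ereal b - enn2ereal a = - (enn2ereal a - enn2ereal b)" if "b < \<infinity>" for a b
    using that by (cases a; cases b) (auto simp: enn2ereal_ennreal)
  then show ?thesis
    using assms by (simp add: ext_integral_def)
qed

lemma ext_integral_nonneg:
  assumes "\<And>x. x \<in> space M \<Longrightarrow> 0 \<le> h x"
  shows "ext_integral M h = enn2ereal (\<integral>\<^sup>+ x. ennreal (h x) \<partial>M)"
proof -
  have "(\<integral>\<^sup>+ x. ennreal (- h x) \<partial>M) = (\<integral>\<^sup>+ x. 0 \<partial>M)"
    by (intro nn_integral_cong) (use assms in \<open>auto simp: ennreal_neg\<close>)
  then show ?thesis by (simp add: ext_integral_def zero_ennreal.rep_eq)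
qed

text \<open>Integrating the pointwise bound one variable at a time needs only linearity of the integral,
  not a product measure.\<close>

lemma (in finite_measure) integral_lower_bound:
  fixes f g h :: "'a \<Rightarrow> real"
  assumes int: "integrable M f" "integrable M g" "integrable M h"
    and kernel: "\<And>x y. x \<in> space M \<Longrightarrow> y \<in> space M \<Longrightarrow> k * (f x * g y + f y * g x) \<le> h x + h y"
  shows "k * (\<integral>x. f x \<partial>M) * (\<integral>x. g x \<partial>M) \<le> measure M (space M) * (\<integral>x. h x \<partial>M)"
proof -
  let ?F = "\<integral>x. f x \<partial>M" and ?G = "\<integral>x. g x \<partial>M" and ?H = "\<integral>x. h x \<partial>M"
  let ?m = "measure M (space M)"
  have inner: "k * (?F * g y + f y * ?G) \<le> ?H + ?m * h y" if y: "y \<in> space M" for y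
  proof -
    have "(\<integral>x. k * (f x * g y + f y * g x) \<partial>M) \<le> (\<integral>x. h x + h y \<partial>M)"
      using int y by (intro integral_mono kernel) auto
    then show ?thesis using int by simp
  qed
  have "(\<integral>y. k * (?F * g y + f y * ?G) \<partial>M) \<le> (\<integral>y. ?H + ?m * h y \<partial>M)"
    using int by (intro integral_mono inner) auto
  then have "2 * (k * ?F * ?G) \<le> 2 * (?m * ?H)"
    using int by (simp add: algebra_simps)
  then show ?thesis by simp
qed

text \<open>A non-integrable \<open>h\<close> has an integrable lower bound, obtained by fixing one of the two points,
  so its integral can only be \<open>\<infinity>\<close>.\<close>

lemma (in finite_measure) ext_integral_lower_bound:
  fixes f g h :: "'a \<Rightarrow> real"
  assumes pos: "0 < measure M (space M)"
    and int: "integrable M f" "integrable M g" and meas: "h \<in> borel_measurable M"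
    and kernel: "\<And>x y. x \<in> space M \<Longrightarrow> y \<in> space M \<Longrightarrow> k * (f x * g y + f y * g x) \<le> h x + h y"
  shows "(\<integral>\<^sup>+ x. ennreal (- h x) \<partial>M) < \<infinity>"
    and "ereal (k * (1 / measure M (space M)) * (\<integral>x. f x \<partial>M) * (\<integral>x. g x \<partial>M)) \<le> ext_integral M h"
proof -
  have "space M \<noteq> {}" using pos by auto
  then obtain z where z: "z \<in> space M" by auto
  define r where "r x = h z - k * (f x * g z + f z * g x)" for x
  have "integrable M r" unfolding r_def using int by auto
  then have "(\<integral>\<^sup>+ x. ennreal (r x) \<partial>M) < \<infinity>"
    by (simp add: real_integrable_def less_top)
  moreover have "(\<integral>\<^sup>+ x. ennreal (- h x) \<partial>M) \<le> (\<integral>\<^sup>+ x. ennreal (r x) \<partial>M)"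
  proof (intro nn_integral_mono ennreal_leI)
    fix x assume "x \<in> space M"
    from kernel[OF this z] show "- h x \<le> r x" by (simp add: r_def)
  qed
  ultimately show neg: "(\<integral>\<^sup>+ x. ennreal (- h x) \<partial>M) < \<infinity>" by (rule le_less_trans[rotated])
  show "ereal (k * (1 / measure M (space M)) * (\<integral>x. f x \<partial>M) * (\<integral>x. g x \<partial>M)) \<le> ext_integral M h"
  proof (cases "integrable M h")
    case True
    from integral_lower_bound[OF int True kernel] pos show ?thesis
      by (simp add: ext_integral_eq_integral[OF True] field_simps)
  next
    case False
    then have "(\<integral>\<^sup>+ x. ennreal (h x) \<partial>M) = \<infinity>"
      using neg meas by (auto simp: real_integrable_def)
    moreover obtain t where "(\<integral>\<^sup>+ x. ennreal (- h x) \<partial>M) = ennreal t" "0 \<le> t"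
      using neg by (cases "\<integral>\<^sup>+ x. ennreal (- h x) \<partial>M") auto
    ultimately have "ext_integral M h = \<infinity>"
      by (simp add: ext_integral_def enn2ereal_ennreal)
    then show ?thesis by simp
  qed
qed

text \<open>The upper bound is the lower bound for \<open>-h\<close>.\<close>

lemma (in finite_measure) ext_integral_upper_bound:
  fixes f g h :: "'a \<Rightarrow> real"
  assumes pos: "0 < measure M (space M)"
    and int: "integrable M f" "integrable M g" and meas: "h \<in> borel_measurable M"
    and kernel: "\<And>x y. x \<in> space M \<Longrightarrow> y \<in> space M \<Longrightarrow> h x + h y \<le> k * (f x * g y + f y * g x)"
  shows "(\<integral>\<^sup>+ x. ennreal (h x) \<partial>M) < \<infinity>"
    and "ext_integral M h \<le> ereal (k * (1 / measure M (space M)) * (\<integral>x. f x \<partial>M) * (\<integral>x. g x \<partial>M))"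
proof -
  have kernel': "- k * (f x * g y + f y * g x) \<le> - h x + - h y"
    if "x \<in> space M" "y \<in> space M" for x y
    using kernel[OF that] by simp
  have meas': "(\<lambda>x. - h x) \<in> borel_measurable M" using meas by simp
  note lower = ext_integral_lower_bound[OF pos int meas' kernel']
  show fin: "(\<integral>\<^sup>+ x. ennreal (h x) \<partial>M) < \<infinity>" using lower(1) by simp
  have "ext_integral M h = - ext_integral M (\<lambda>x. - h x)"
    using ext_integral_uminus[of M "\<lambda>x. - h x"] fin by simp
  also have "\<dots> \<le> - ereal (- k * (1 / measure M (space M)) * (\<integral>x. f x \<partial>M) * (\<integral>x. g x \<partial>M))"
    using lower(2) by (simp only: ereal_minus_le_minus)
  finally show "ext_integral M h
      \<le> ereal (k * (1 / measure M (space M)) * (\<integral>x. f x \<partial>M) * (\<integral>x. g x \<partial>M))"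
    by simp
qed

section \<open>Pointwise inequalities and constants\<close>

text \<open>For \<open>S = 1\<close> this is the rearrangement inequality.  In general \<open>(S p - a) (S q - d) \<ge> 0\<close>
  bounds \<open>S (p d + a q)\<close> by \<open>S\<^sup>2 p q + a d\<close>, and \<open>S\<^sup>2 \<ge> 1\<close> absorbs the asymmetry.\<close>

lemma rearrangement_up_to_factor:
  fixes a d p q S :: real
  assumes "0 \<le> a" "0 \<le> d" "1 \<le> S" "a \<le> S * p" "d \<le> S * q"
  shows "p * d + a * q \<le> S * (p * q + a * d)"
proof -
  have "0 \<le> (S * p - a) * (S * q - d)" using assms by simp
  then have "S * (p * d + a * q) \<le> S * S * (p * q) + a * d" by (simp add: algebra_simps)
  moreover have "1 * (a * d) \<le> S * S * (a * d)"
    using assms by (intro mult_right_mono) (auto intro: order_trans[OF _ mult_mono[of 1 S 1 S]])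
  ultimately have "S * (p * d + a * q) \<le> S * (S * (p * q + a * d))" by (simp add: algebra_simps)
  then show ?thesis using assms by simp
qed

lemma star_ge: "1 \<le> star b" "b \<le> star b" if "0 < b"
  using that by (auto simp: star_def le_max_iff_disj field_simps)

text \<open>Because \<open>S = max (star b) (star c)\<close> dominates both \<open>b\<close> and \<open>c\<close>, weak synchronicity survives
  when both constants are replaced by \<open>S\<close>; nonnegativity of the functions is essential here.\<close>

lemma weakly_synchronous_kernel:
  assumes sync: "weakly_synchronous X b c f g" and "0 < b" "0 < c"
    and nonneg: "\<And>x. x \<in> X \<Longrightarrow> 0 \<le> f x" "\<And>x. x \<in> X \<Longrightarrow> 0 \<le> g x"
    and x: "x \<in> X" and y: "y \<in> X"
  shows "f x * g y + f y * g x \<le> max (star b) (star c) * (f x * g x + f y * g y)"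
proof -
  let ?S = "max (star b) (star c)"
  have S: "1 \<le> ?S" "b \<le> ?S" "c \<le> ?S"
    using star_ge[OF \<open>0 < b\<close>] star_ge[OF \<open>0 < c\<close>] by auto
  have f: "s \<le> ?S * f z" if "s \<le> b * f z" "z \<in> X" for s z
    using that order_trans[OF _ mult_right_mono[OF S(2)]] nonneg by blast
  have g: "s \<le> ?S * g z" if "s \<le> c * g z" "z \<in> X" for s z
    using that order_trans[OF _ mult_right_mono[OF S(3)]] nonneg by blast
  from sync x y consider "f x \<le> b * f y" "g x \<le> c * g y" | "f y \<le> b * f x" "g y \<le> c * g x"
    unfolding weakly_synchronous_def by blast
  then show ?thesis
  proof cases
    case 1
    then show ?thesis
      using rearrangement_up_to_factor[OF nonneg(1)[OF x] nonneg(2)[OF x] S(1) f[OF _ y] g[OF _ y]]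
      by (simp add: add.commute)
  next
    case 2
    then show ?thesis
      using rearrangement_up_to_factor[OF nonneg(1)[OF y] nonneg(2)[OF y] S(1) f[OF _ x] g[OF _ x]]
      by (simp add: add.commute)
  qed
qed

text \<open>In the asynchronous case the same inequality is used with the two values of \<open>g\<close> exchanged.\<close>

lemma weakly_asynchronous_kernel:
  assumes async: "weakly_asynchronous X b c f g" and "0 < b" "0 < c"
    and nonneg: "\<And>x. x \<in> X \<Longrightarrow> 0 \<le> f x" "\<And>x. x \<in> X \<Longrightarrow> 0 \<le> g x"
    and x: "x \<in> X" and y: "y \<in> X"
  shows "f x * g x + f y * g y \<le> max (star b) (star c) * (f x * g y + f y * g x)"
proof -
  let ?S = "max (star b) (star c)"
  have S: "1 \<le> ?S" "b \<le> ?S" "c \<le> ?S"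
    using star_ge[OF \<open>0 < b\<close>] star_ge[OF \<open>0 < c\<close>] by auto
  have f: "s \<le> ?S * f z" if "s \<le> b * f z" "z \<in> X" for s z
    using that order_trans[OF _ mult_right_mono[OF S(2)]] nonneg by blast
  have g: "s \<le> ?S * g z" if "s \<le> c * g z" "z \<in> X" for s z
    using that order_trans[OF _ mult_right_mono[OF S(3)]] nonneg by blast
  from async x y consider "f x \<le> b * f y" "g y \<le> c * g x" | "f y \<le> b * f x" "g x \<le> c * g y"
    unfolding weakly_asynchronous_def by blast
  then show ?thesis
  proof cases
    case 1
    then show ?thesis
      using rearrangement_up_to_factor[OF nonneg(1)[OF x] nonneg(2)[OF y] S(1) f[OF _ y] g[OF _ x]]
      by (simp add: add.commute)
  next
    case 2
    then show ?thesis
      using rearrangement_up_to_factor[OF nonneg(1)[OF y] nonneg(2)[OF x] S(1) f[OF _ x] g[OF _ y]]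
      by (simp add: add.commute)
  qed
qed

text \<open>If \<open>C \<le> B\<close>, multiplying out the denominator reduces both comparisons of constants to
  \<open>1 / C \<le> C\<close>.\<close>

lemma sync_constant_le:
  fixes B C :: real
  assumes "1 \<le> B" "1 \<le> C"
  shows "(inverse B + inverse C) / (1 + B * C) \<le> 1 / max B C"
proof -
  have ordered: "(inverse B + inverse C) / (1 + B * C) \<le> 1 / B" if "1 \<le> C" "C \<le> B" for B C :: real
  proof -
    have "inverse C \<le> C" using that order_trans[of "inverse C" 1 C] by (simp add: inverse_le_1_iff)
    then have "inverse B + inverse C \<le> 1 / B * (1 + B * C)"
      using that by (simp add: distrib_left inverse_eq_divide)
    moreover have "0 < 1 + B * C" using that by (simp add: add_pos_nonneg)
    ultimately show ?thesis by (simp only: pos_divide_le_eq)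
  qed
  show ?thesis
    using ordered[of B C] ordered[of C B] assms by (auto simp: max_def ac_simps)
qed

lemma async_constant_ge:
  fixes B C :: real
  assumes "1 \<le> B" "1 \<le> C"
  shows "max B C \<le> (B + C) / (1 + inverse B * inverse C)"
proof -
  have ordered: "B \<le> (B + C) / (1 + inverse B * inverse C)" if "1 \<le> C" "C \<le> B" for B C :: real
  proof -
    have "inverse C \<le> C" using that order_trans[of "inverse C" 1 C] by (simp add: inverse_le_1_iff)
    then have "B * (1 + inverse B * inverse C) \<le> B + C"
      using that by (simp add: distrib_left flip: mult.assoc)
    moreover have "0 < 1 + inverse B * inverse C" using that by (simp add: add_pos_nonneg)
    ultimately show ?thesis by (simp only: pos_le_divide_eq)
  qed
  show ?thesis
    using ordered[of B C] ordered[of C B] assms by (auto simp: max_def ac_simps)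
qed

lemma weakly_synchronous_1_1_iff:
  "weakly_synchronous X 1 1 u v \<longleftrightarrow> (\<forall>x\<in>X. \<forall>y\<in>X. 0 \<le> (u x - u y) * (v x - v y))"
  unfolding weakly_synchronous_def by (auto simp: zero_le_mult_iff)

lemma weakly_asynchronous_1_1_iff:
  "weakly_asynchronous X 1 1 u v \<longleftrightarrow> (\<forall>x\<in>X. \<forall>y\<in>X. (u x - u y) * (v x - v y) \<le> 0)"
  unfolding weakly_asynchronous_def by (auto simp: mult_le_0_iff)

section \<open>Chebyshev inequalities\<close>

lemma (in finite_measure) weakly_synchronous_Chebyshev:
  assumes pos: "0 < measure M (space M)" and int: "integrable M f" "integrable M g"
    and nonneg: "\<And>x. x \<in> space M \<Longrightarrow> 0 \<le> f x" "\<And>x. x \<in> space M \<Longrightarrow> 0 \<le> g x"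
    and bc: "0 < b" "0 < c" and sync: "weakly_synchronous (space M) b c f g"
  shows "ennreal ((inverse (star b) + inverse (star c)) / (1 + star b * star c)
           * (1 / measure M (space M)) * (\<integral>x. g x \<partial>M) * (\<integral>x. f x \<partial>M))
         \<le> (\<integral>\<^sup>+ x. ennreal (f x * g x) \<partial>M)"
proof -
  let ?S = "max (star b) (star c)"
  have S: "0 < ?S" using star_ge(1)[OF bc(1)] by auto
  have kernel: "(1 / ?S) * (f x * g y + f y * g x) \<le> f x * g x + f y * g y"
    if "x \<in> space M" "y \<in> space M" for x y
    using weakly_synchronous_kernel[OF sync bc nonneg that] S
    by (simp add: pos_divide_le_eq mult.commute)
  have FG: "0 \<le> (1 / measure M (space M)) * ((\<integral>x. g x \<partial>M) * (\<integral>x. f x \<partial>M))"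
    using nonneg by (intro mult_nonneg_nonneg integral_nonneg) auto
  have meas: "(\<lambda>x. f x * g x) \<in> borel_measurable M" using int by auto
  have "(inverse (star b) + inverse (star c)) / (1 + star b * star c)
          * (1 / measure M (space M)) * (\<integral>x. g x \<partial>M) * (\<integral>x. f x \<partial>M)
        \<le> (1 / ?S) * (1 / measure M (space M)) * (\<integral>x. f x \<partial>M) * (\<integral>x. g x \<partial>M)" (is "?l \<le> ?r")
    using mult_right_mono[OF sync_constant_le[OF star_ge(1)[OF bc(1)] star_ge(1)[OF bc(2)]] FG]
    by (simp add: ac_simps)
  also have "ereal ?r \<le> ext_integral M (\<lambda>x. f x * g x)"
    by (rule ext_integral_lower_bound(2)[OF pos int meas kernel])
  also have "\<dots> = enn2ereal (\<integral>\<^sup>+ x. ennreal (f x * g x) \<partial>M)"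
    using nonneg by (intro ext_integral_nonneg) auto
  finally have "ereal ?l \<le> enn2ereal (\<integral>\<^sup>+ x. ennreal (f x * g x) \<partial>M)" by simp
  then show ?thesis
    by (cases "\<integral>\<^sup>+ x. ennreal (f x * g x) \<partial>M") (auto simp: enn2ereal_ennreal intro: ennreal_leI)
qed

lemma (in finite_measure) weakly_asynchronous_Chebyshev:
  assumes pos: "0 < measure M (space M)" and int: "integrable M f" "integrable M g"
    and nonneg: "\<And>x. x \<in> space M \<Longrightarrow> 0 \<le> f x" "\<And>x. x \<in> space M \<Longrightarrow> 0 \<le> g x"
    and bc: "0 < b" "0 < c" and async: "weakly_asynchronous (space M) b c f g"
  shows "(\<integral>\<^sup>+ x. ennreal (f x * g x) \<partial>M)
         \<le> ennreal ((star b + star c) / (1 + inverse (star b) * inverse (star c))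
           * (1 / measure M (space M)) * (\<integral>x. g x \<partial>M) * (\<integral>x. f x \<partial>M))"
proof -
  let ?S = "max (star b) (star c)"
  have FG: "0 \<le> (1 / measure M (space M)) * ((\<integral>x. g x \<partial>M) * (\<integral>x. f x \<partial>M))"
    using nonneg by (intro mult_nonneg_nonneg integral_nonneg) auto
  have meas: "(\<lambda>x. f x * g x) \<in> borel_measurable M" using int by auto
  have "enn2ereal (\<integral>\<^sup>+ x. ennreal (f x * g x) \<partial>M) = ext_integral M (\<lambda>x. f x * g x)"
    using nonneg by (intro ext_integral_nonneg[symmetric]) auto
  also have "\<dots> \<le> ereal (?S * (1 / measure M (space M)) * (\<integral>x. f x \<partial>M) * (\<integral>x. g x \<partial>M))"
    by (rule ext_integral_upper_bound(2)[OF pos int meas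
          weakly_asynchronous_kernel[OF async bc nonneg]])
  also have "?S * (1 / measure M (space M)) * (\<integral>x. f x \<partial>M) * (\<integral>x. g x \<partial>M)
      \<le> (star b + star c) / (1 + inverse (star b) * inverse (star c))
          * (1 / measure M (space M)) * (\<integral>x. g x \<partial>M) * (\<integral>x. f x \<partial>M)" (is "_ \<le> ?r")
    using mult_right_mono[OF async_constant_ge[OF star_ge(1)[OF bc(1)] star_ge(1)[OF bc(2)]] FG]
    by (simp add: ac_simps)
  finally have "enn2ereal (\<integral>\<^sup>+ x. ennreal (f x * g x) \<partial>M) \<le> ereal ?r" by simp
  then show ?thesis
    by (cases "\<integral>\<^sup>+ x. ennreal (f x * g x) \<partial>M") (auto simp: enn2ereal_ennreal intro: ennreal_leI)
qed

lemma (in finite_measure) synchronous_Chebyshev: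
  fixes u v :: "'a \<Rightarrow> real"
  assumes pos: "0 < measure M (space M)" and int: "integrable M u" "integrable M v"
    and sync: "\<forall>x\<in>space M. \<forall>y\<in>space M. 0 \<le> (u x - u y) * (v x - v y)"
  shows "(\<integral>\<^sup>+ x. ennreal (- (u x * v x)) \<partial>M) < \<infinity>"
    and "ereal (1 / measure M (space M) * (\<integral>x. u x \<partial>M) * (\<integral>x. v x \<partial>M))
         \<le> ext_integral M (\<lambda>x. u x * v x)"
proof -
  have kernel: "1 * (u x * v y + u y * v x) \<le> u x * v x + u y * v y"
    if "x \<in> space M" "y \<in> space M" for x y
    using sync that by (fastforce simp: algebra_simps)
  have meas: "(\<lambda>x. u x * v x) \<in> borel_measurable M" using int by auto
  show "(\<integral>\<^sup>+ x. ennreal (- (u x * v x)) \<partial>M) < \<infinity>"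
    by (rule ext_integral_lower_bound(1)[OF pos int meas kernel])
  show "ereal (1 / measure M (space M) * (\<integral>x. u x \<partial>M) * (\<integral>x. v x \<partial>M))
         \<le> ext_integral M (\<lambda>x. u x * v x)"
    using ext_integral_lower_bound(2)[OF pos int meas kernel] by simp
qed

lemma (in finite_measure) asynchronous_Chebyshev:
  fixes u v :: "'a \<Rightarrow> real"
  assumes pos: "0 < measure M (space M)" and int: "integrable M u" "integrable M v"
    and async: "\<forall>x\<in>space M. \<forall>y\<in>space M. (u x - u y) * (v x - v y) \<le> 0"
  shows "(\<integral>\<^sup>+ x. ennreal (u x * v x) \<partial>M) < \<infinity>"
    and "ext_integral M (\<lambda>x. u x * v x)
         \<le> ereal (1 / measure M (space M) * (\<integral>x. u x \<partial>M) * (\<integral>x. v x \<partial>M))"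
proof -
  have kernel: "u x * v x + u y * v y \<le> 1 * (u x * v y + u y * v x)"
    if "x \<in> space M" "y \<in> space M" for x y
    using async that by (fastforce simp: algebra_simps)
  have meas: "(\<lambda>x. u x * v x) \<in> borel_measurable M" using int by auto
  show "(\<integral>\<^sup>+ x. ennreal (u x * v x) \<partial>M) < \<infinity>"
    by (rule ext_integral_upper_bound(1)[OF pos int meas kernel])
  show "ext_integral M (\<lambda>x. u x * v x)
         \<le> ereal (1 / measure M (space M) * (\<integral>x. u x \<partial>M) * (\<integral>x. v x \<partial>M))"
    using ext_integral_upper_bound(2)[OF pos int meas kernel] by simp
qed

theorem theorem2p8:
  fixes M :: "'a measure"
  assumes "0 < emeasure M (space M)" and "emeasure M (space M) < \<infinity>"
  shows
    "(\<forall>(f :: 'a \<Rightarrow> real) (g :: 'a \<Rightarrow> real) (b :: real) (c :: real).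
        integrable M f \<and> integrable M g \<and>
        (\<forall>x\<in>space M. 0 \<le> f x) \<and> (\<forall>x\<in>space M. 0 \<le> g x) \<and> 0 < b \<and> 0 < c \<longrightarrow>
        (weakly_synchronous (space M) b c f g \<longrightarrow>
           (\<integral>\<^sup>+ x. ennreal (f x * g x) \<partial>M) \<ge>
           ennreal ((inverse (star b) + inverse (star c)) / (1 + star b * star c)
              * (1 / measure M (space M)) * (\<integral>x. g x \<partial>M) * (\<integral>x. f x \<partial>M))) \<and>
        (weakly_asynchronous (space M) b c f g \<longrightarrow>
           (\<integral>\<^sup>+ x. ennreal (f x * g x) \<partial>M) \<le>
           ennreal ((star b + star c) / (1 + inverse (star b) * inverse (star c))
              * (1 / measure M (space M)) * (\<integral>x. g x \<partial>M) * (\<integral>x. f x \<partial>M))))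
   \<and> (\<forall>(u :: 'a \<Rightarrow> real) (v :: 'a \<Rightarrow> real).
        (weakly_synchronous (space M) 1 1 u v \<longleftrightarrow>
           (\<forall>x\<in>space M. \<forall>y\<in>space M. (u x - u y) * (v x - v y) \<ge> 0)) \<and>
        (weakly_asynchronous (space M) 1 1 u v \<longleftrightarrow>
           (\<forall>x\<in>space M. \<forall>y\<in>space M. (u x - u y) * (v x - v y) \<le> 0)))
   \<and> (\<forall>(u :: 'a \<Rightarrow> real) (v :: 'a \<Rightarrow> real).
        integrable M u \<and> integrable M v \<longrightarrow>
        ((\<forall>x\<in>space M. \<forall>y\<in>space M. (u x - u y) * (v x - v y) \<ge> 0) \<longrightarrow>
           (\<integral>\<^sup>+ x. ennreal (- (u x * v x)) \<partial>M) < \<infinity> \<and>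
           ext_integral M (\<lambda>x. u x * v x) \<ge>
           ereal (1 / measure M (space M) * (\<integral>x. u x \<partial>M) * (\<integral>x. v x \<partial>M))) \<and>
        ((\<forall>x\<in>space M. \<forall>y\<in>space M. (u x - u y) * (v x - v y) \<le> 0) \<longrightarrow>
           (\<integral>\<^sup>+ x. ennreal (u x * v x) \<partial>M) < \<infinity> \<and>
           ext_integral M (\<lambda>x. u x * v x) \<le>
           ereal (1 / measure M (space M) * (\<integral>x. u x \<partial>M) * (\<integral>x. v x \<partial>M))))"
proof -
  interpret finite_measure M
    by (rule finite_measureI) (use assms(2) in auto)
  have pos: "0 < measure M (space M)"
    using assms(1) by (simp add: emeasure_eq_measure)
  show ?thesis
  proof (intro conjI allI impI, goal_cases)
    case (1 f g b c)
    then show ?case by (intro weakly_synchronous_Chebyshev[OF pos]) auto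
  next
    case (2 f g b c)
    then show ?case by (intro weakly_asynchronous_Chebyshev[OF pos]) auto
  next
    case (3 u v)
    show ?case by (rule weakly_synchronous_1_1_iff)
  next
    case (4 u v)
    show ?case by (rule weakly_asynchronous_1_1_iff)
  next
    case (5 u v)
    then show ?case by (intro synchronous_Chebyshev(1)[OF pos]) auto
  next
    case (6 u v)
    then show ?case by (intro synchronous_Chebyshev(2)[OF pos]) auto
  next
    case (7 u v)
    then show ?case by (intro asynchronous_Chebyshev(1)[OF pos]) auto
  next
    case (8 u v)
    then show ?case by (intro asynchronous_Chebyshev(2)[OF pos]) auto
  qed
qed

end
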